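(* Put $$A_{l,m}=2^{R_{l,m}^{\min}/B_c}\ (l=1,2),\quad \Upsilon_m=\frac{A_{2,m}(A_{1,m}-1)}{\Gamma_{1,m}}+\frac{A_{2,m}-1}{\Gamma_{2,m}},\quad \Xi_m=\frac{\Gamma_{2,m}q_m-A_{2,m}+1}{A_{2,m}\Gamma_{2,m}}.$$ Suppose that $\Gamma_{1,m}\ge\Gamma_{2,m}$, $A_{2,m}\ge2$ and $q_m\ge\Upsilon_m$. Then the optimal solution to the problem $$\max_{p_{1,m},p_{2,m}}\ R_{1,m}+R_{2,m}\quad\text{s.t.}\quad 0\le p_{1,m}\le p_{2,m},\ p_{1,m}+p_{2,m}=q_m,\ R_{1,m}\ge R_{1,m}^{\min},\ R_{2,m}\ge R_{2,m}^{\min},$$ where $R_{1,m}=B_c\log(1+p_{1,m}\Gamma_{1,m})$ and $R_{2,m}=B_c\log\left(1+\frac{p_{2,m}\Gamma_{2,m}}{p_{1,m}\Gamma_{2,m}+1}\right)$, is given by $p_{1,m}^\star=\Xi_m$ and $p_{2,m}^\star=q_m-p_{1,m}^\star$.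
   Context: Setting: downlink two-user NOMA (non-orthogonal multiple access) on a channel $m$ of bandwidth $B_c>0$; $\Gamma_{l,m}>0$ is the channel-to-noise ratio of user $l$ on channel $m$, $p_{l,m}$ its power, $R_{l,m}$ its rate, $R_{l,m}^{\min}$ its quality-of-service threshold, and $q_m$ the given power budget of the channel. $\log$ is the base-2 logarithm.
   Formalization: The thresholds R^min are assumed nonnegative (for R_1^min < 0 the point Ξ can be negative, hence infeasible), and the optimum is claimed to be unique only when Γ_1 > Γ_2, since for Γ_1 = Γ_2 the sum rate is constant on the feasible set. *)

theory Defs
  imports Complex_Main
begin

(* All quantities belong to one fixed channel, so the channel index is dropped.
   B is the bandwidth, G1 and G2 are the channel-to-noise ratios, r1 and r2 the
   quality-of-service thresholds, q the power budget, p = (p1, p2) the powers. *)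

definition rate1 :: "real \<Rightarrow> real \<Rightarrow> real \<times> real \<Rightarrow> real" where
  "rate1 B G1 = (\<lambda>(p1, p2). B * log 2 (1 + p1 * G1))"

definition rate2 :: "real \<Rightarrow> real \<Rightarrow> real \<times> real \<Rightarrow> real" where
  "rate2 B G2 = (\<lambda>(p1, p2). B * log 2 (1 + p2 * G2 / (p1 * G2 + 1)))"

definition sum_rate :: "real \<Rightarrow> real \<Rightarrow> real \<Rightarrow> real \<times> real \<Rightarrow> real" where
  "sum_rate B G1 G2 p = rate1 B G1 p + rate2 B G2 p"

definition feasible ::
  "real \<Rightarrow> real \<Rightarrow> real \<Rightarrow> real \<Rightarrow> real \<Rightarrow> real \<Rightarrow> real \<times> real \<Rightarrow> bool" where
  "feasible B G1 G2 r1 r2 q p \<longleftrightarrow>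
     0 \<le> fst p \<and> fst p \<le> snd p \<and> fst p + snd p = q \<and>
     rate1 B G1 p \<ge> r1 \<and> rate2 B G2 p \<ge> r2"

definition qos_factor :: "real \<Rightarrow> real \<Rightarrow> real" where
  "qos_factor B r = 2 powr (r / B)"

definition Upsilon :: "real \<Rightarrow> real \<Rightarrow> real \<Rightarrow> real \<Rightarrow> real" where
  "Upsilon A1 A2 G1 G2 = A2 * (A1 - 1) / G1 + (A2 - 1) / G2"

definition Xi :: "real \<Rightarrow> real \<Rightarrow> real \<Rightarrow> real" where
  "Xi A2 G2 q = (G2 * q - A2 + 1) / (A2 * G2)"

end

theory Submission
  imports Defs
begin

text \<open>
  Exhausting the budget makes the second rate \<open>B log ((1 + q G2) / (1 + x G2))\<close> at \<open>p1 = x\<close>.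
  Hence the second quality-of-service constraint says exactly \<open>x \<le> Xi\<close>, the hypothesis on \<open>q\<close>
  says exactly that \<open>Xi\<close> meets the first one, and \<open>A2 \<ge> 2\<close> yields \<open>Xi \<le> q - Xi\<close>. The sum rate is
  \<open>B log ((1 + q G2) (1 + x G1) / (1 + x G2))\<close>, which is nondecreasing in \<open>x\<close> for \<open>G1 \<ge> G2\<close> and
  strictly increasing for \<open>G1 > G2\<close>, so the upper end \<open>x = Xi\<close> is optimal.
\<close>

text \<open>Dividing by \<open>B\<close> and exponentiating to base 2 moves a rate threshold onto
  the argument of the logarithm.\<close>

lemma qos_factor_le_iff:
  assumes "B > 0" and "y > 0"
  shows "r \<le> B * log 2 y \<longleftrightarrow> qos_factor B r \<le> y"
proof -
  have "r \<le> B * log 2 y \<longleftrightarrow> r / B \<le> log 2 y"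
    using assms by (simp add: pos_divide_le_eq mult.commute)
  also have "\<dots> \<longleftrightarrow> qos_factor B r \<le> y"
    using assms by (simp add: qos_factor_def le_log_iff)
  finally show ?thesis .
qed

lemma qos_factor_ge_1:
  assumes "B > 0" and "r \<ge> 0"
  shows "qos_factor B r \<ge> 1"
  using assms by (simp add: qos_factor_def ge_one_powr_ge_zero)

lemma rate1_ge_iff:
  assumes "B > 0" and "G1 > 0" and "x \<ge> 0"
  shows "r \<le> rate1 B G1 (x, y) \<longleftrightarrow> (qos_factor B r - 1) / G1 \<le> x"
proof -
  have "1 + x * G1 > 0"
    using assms by (simp add: add_pos_nonneg)
  then show ?thesis
    using assms by (simp add: rate1_def qos_factor_le_iff pos_divide_le_eq) linarith
qed

text \<open>Signal plus interference has strength \<open>q * G2\<close> for every split of the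
  budget, so \<open>x\<close> survives only in the denominator.\<close>

lemma rate2_full_budget:
  assumes "G2 > 0" and "x \<ge> 0"
  shows "rate2 B G2 (x, q - x) = B * log 2 ((1 + q * G2) / (1 + x * G2))"
proof -
  have "1 + x * G2 > 0"
    using assms by (simp add: add_pos_nonneg)
  then have "1 + (q - x) * G2 / (x * G2 + 1) = (1 + q * G2) / (1 + x * G2)"
    by (simp add: field_simps)
  then show ?thesis
    by (simp add: rate2_def)
qed

lemma rate2_ge_iff:
  assumes "B > 0" and "G2 > 0" and "x \<ge> 0" and "q \<ge> 0"
  shows "r \<le> rate2 B G2 (x, q - x) \<longleftrightarrow> x \<le> Xi (qos_factor B r) G2 q"
proof -
  have pos: "1 + x * G2 > 0" "1 + q * G2 > 0"
    using assms by (simp_all add: add_pos_nonneg)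
  have A: "qos_factor B r > 0"
    by (simp add: qos_factor_def)
  have "r \<le> rate2 B G2 (x, q - x) \<longleftrightarrow> qos_factor B r * (1 + x * G2) \<le> 1 + q * G2"
    using assms pos by (simp add: rate2_full_budget qos_factor_le_iff pos_le_divide_eq)
  also have "\<dots> \<longleftrightarrow> x * (qos_factor B r * G2) \<le> G2 * q - qos_factor B r + 1"
    by (simp add: algebra_simps)
  also have "\<dots> \<longleftrightarrow> x \<le> Xi (qos_factor B r) G2 q"
    using assms A by (simp add: Xi_def pos_le_divide_eq)
  finally show ?thesis .
qed

lemma feasible_iff:
  assumes "B > 0" and "G1 > 0" and "G2 > 0" and "q \<ge> 0"
  shows "feasible B G1 G2 r1 r2 q p \<longleftrightarrow>
    (\<exists>x. p = (x, q - x) \<and> 0 \<le> x \<and> x \<le> q - x \<and>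
      (qos_factor B r1 - 1) / G1 \<le> x \<and> x \<le> Xi (qos_factor B r2) G2 q)"
proof (cases p)
  case (Pair x y)
  show ?thesis
  \<comment> \<open>The rate equivalences require \<open>0 \<le> x\<close>; if the case condition
    fails, both sides are false.\<close>
  proof (cases "y = q - x \<and> 0 \<le> x")
    case True
    then show ?thesis
      using assms Pair by (simp add: feasible_def rate1_ge_iff rate2_ge_iff)
  next
    case False
    then show ?thesis
      using Pair by (auto simp: feasible_def)
  qed
qed

lemma sum_rate_full_budget:
  assumes "G1 > 0" and "G2 > 0" and "x \<ge> 0" and "q \<ge> 0"
  shows "sum_rate B G1 G2 (x, q - x) =
    B * log 2 (1 + q * G2) + B * log 2 ((1 + x * G1) / (1 + x * G2))"
proof -
  have "1 + x * G1 > 0" "1 + x * G2 > 0" "1 + q * G2 > 0"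
    using assms by (simp_all add: add_pos_nonneg)
  then show ?thesis
    using assms
    by (simp add: sum_rate_def rate1_def rate2_full_budget log_divide right_diff_distrib)
qed

text \<open>The common summand cancels and the logarithm is monotone; cross-multiplication then
  leaves only this product. Being an equivalence, it serves both optimality and uniqueness.\<close>

lemma sum_rate_less_iff:
  assumes "B > 0" and "G1 > 0" and "G2 > 0" and "x \<ge> 0" and "y \<ge> 0" and "q \<ge> 0"
  shows "sum_rate B G1 G2 (x, q - x) < sum_rate B G1 G2 (y, q - y) \<longleftrightarrow>
    0 < (y - x) * (G1 - G2)"
proof -
  have pos: "1 + x * G1 > 0" "1 + x * G2 > 0" "1 + y * G1 > 0" "1 + y * G2 > 0" "1 + q * G2 > 0"
    using assms by (simp_all add: add_pos_nonneg)
  have "sum_rate B G1 G2 (x, q - x) < sum_rate B G1 G2 (y, q - y) \<longleftrightarrow>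
      (1 + x * G1) / (1 + x * G2) < (1 + y * G1) / (1 + y * G2)"
    using assms pos by (simp add: sum_rate_full_budget)
  also have "\<dots> \<longleftrightarrow> (1 + x * G1) * (1 + y * G2) < (1 + y * G1) * (1 + x * G2)"
    using pos by (simp add: divide_less_eq pos_less_divide_eq)
  also have "\<dots> \<longleftrightarrow> 0 < (y - x) * (G1 - G2)"
    by (simp add: algebra_simps)
  finally show ?thesis .
qed

text \<open>\<open>Upsilon\<close> is the budget at which \<open>Xi\<close> equals the least first
  power that the first threshold allows.\<close>

lemma Xi_ge_iff:
  assumes "G2 > 0" and "A2 > 0"
  shows "(A1 - 1) / G1 \<le> Xi A2 G2 q \<longleftrightarrow> Upsilon A1 A2 G1 G2 \<le> q"
proof -
  define c where "c = (A1 - 1) / G1"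
  have "c \<le> Xi A2 G2 q \<longleftrightarrow> A2 * c + (A2 - 1) / G2 \<le> q"
    using assms by (simp add: Xi_def field_simps)
  then show ?thesis
    by (simp add: c_def Upsilon_def)
qed

lemma Xi_le_half_budget:
  assumes "G2 > 0" and "A2 \<ge> 2" and "q \<ge> 0"
  shows "Xi A2 G2 q \<le> q - Xi A2 G2 q"
proof -
  \<comment> \<open>This is \<open>q - 2 * Xi A2 G2 q\<close> multiplied by \<open>A2 * G2\<close>,
    grouped so that \<open>A2 \<ge> 2\<close> makes both summands nonnegative.\<close>
  have "0 \<le> (A2 - 2) * (G2 * q) + 2 * (A2 - 1)"
    using assms by simp
  also have "\<dots> = q * (A2 * G2) - 2 * (G2 * q - A2 + 1)"
    by (simp add: algebra_simps)
  finally have "2 * (G2 * q - A2 + 1) \<le> q * (A2 * G2)"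
    by simp
  then have "2 * Xi A2 G2 q \<le> q"
    using assms by (simp add: Xi_def pos_divide_le_eq)
  then show ?thesis
    by simp
qed

theorem proposition3:
  fixes B G1 G2 r1 r2 q A1 A2 :: real
  assumes "B > 0" and "G1 > 0" and "G2 > 0" and "r1 \<ge> 0" and "r2 \<ge> 0"
    and "A1 = qos_factor B r1" and "A2 = qos_factor B r2"
    and "G1 \<ge> G2" and "A2 \<ge> 2" and "q \<ge> Upsilon A1 A2 G1 G2"
  shows "is_arg_max (sum_rate B G1 G2) (feasible B G1 G2 r1 r2 q)
           (Xi A2 G2 q, q - Xi A2 G2 q) \<and>
         (G1 > G2 \<longrightarrow>
           (\<forall>p. is_arg_max (sum_rate B G1 G2) (feasible B G1 G2 r1 r2 q) p \<longrightarrow>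
             p = (Xi A2 G2 q, q - Xi A2 G2 q)))"
proof -
  let ?S = "sum_rate B G1 G2" and ?F = "feasible B G1 G2 r1 r2 q" and ?X = "Xi A2 G2 q"
  have A1: "A1 \<ge> 1"
    using assms by (simp add: qos_factor_ge_1)
  have "0 \<le> Upsilon A1 A2 G1 G2"
    using assms A1 by (simp add: Upsilon_def)
  with assms have q: "q \<ge> 0"
    by linarith
  have QoS1: "(A1 - 1) / G1 \<le> ?X"
    using assms by (subst Xi_ge_iff) auto
  \<comment> \<open>The lower bound in \<open>QoS1\<close> is itself nonnegative because
    \<open>A1 \<ge> 1\<close>.\<close>
  have X0: "0 \<le> ?X"
    using A1 \<open>G1 > 0\<close> by (intro order_trans[OF _ QoS1]) simp
  have feas: "?F p \<longleftrightarrow>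
      (\<exists>x. p = (x, q - x) \<and> 0 \<le> x \<and> x \<le> q - x \<and> (A1 - 1) / G1 \<le> x \<and> x \<le> ?X)" for p
    unfolding \<open>A1 = qos_factor B r1\<close> \<open>A2 = qos_factor B r2\<close>
    using assms(1-3) q by (rule feasible_iff)
  have FX: "?F (?X, q - ?X)"
    using X0 QoS1 Xi_le_half_budget[OF \<open>G2 > 0\<close> \<open>A2 \<ge> 2\<close> q] by (simp add: feas)
  have "\<not> ?S p > ?S (?X, q - ?X)" if "?F p" for p
  proof -
    obtain x where x: "p = (x, q - x)" "0 \<le> x" "x \<le> ?X"
      using \<open>?F p\<close> feas by blast
    have "(x - ?X) * (G1 - G2) \<le> 0"
      using x \<open>G1 \<ge> G2\<close> by (simp add: mult_nonpos_nonneg)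
    then show ?thesis
      using assms x X0 q by (simp add: sum_rate_less_iff)
  qed
  with FX have opt: "is_arg_max ?S ?F (?X, q - ?X)"
    by (auto simp: is_arg_max_def)
  \<comment> \<open>Strictness matters for uniqueness: if \<open>G1 = G2\<close>, the sum rate is
    constant on the feasible set.\<close>
  have "p = (?X, q - ?X)" if "G1 > G2" and max: "is_arg_max ?S ?F p" for p
  proof -
    obtain x where x: "p = (x, q - x)" "0 \<le> x" "x \<le> ?X"
      using max feas unfolding is_arg_max_def by blast
    have "\<not> ?S p < ?S (?X, q - ?X)"
      using max FX unfolding is_arg_max_def by blast
    then have "\<not> 0 < (?X - x) * (G1 - G2)"
      unfolding x(1) using assms x(2) X0 q by (subst (asm) sum_rate_less_iff) auto
    then have "x = ?X"
      using x(3) \<open>G1 > G2\<close> by (simp add: zero_less_mult_iff)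
    with x show ?thesis
      by simp
  qed
  with opt show ?thesis
    by blast
qed

end
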